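(* For every integer $n\geq 3$, $\alpha\bigl(\Theta(D_{2n})\bigr)=\alpha\bigl(\Theta(\mathbb{Z}_n)\bigr)$.
   Context: $\mathbb{Z}_n$ denotes the cyclic group of order $n$, and $D_{2n}=\langle a,b : a^n=1,\ b^2=1,\ bab^{-1}=a^{-1}\rangle$ is the dihedral group of order $2n$. For a finite group $G$, $|g|$ denotes the order of $g\in G$, and the prime-coprime graph $\Theta(G)$ is the simple graph with vertex set $G$ in which two distinct vertices $g,h$ are adjacent if and only if $\gcd(|g|,|h|)$ is either $1$ or a prime. The independence number $\alpha(\Gamma)$ of a graph $\Gamma$ is the maximum cardinality of an independent set of $\Gamma$. *)

theory Defs
  imports "HOL-Computational_Algebra.Primes" "HOL-Algebra.Elementary_Groups" "HOL-Algebra.Multiplicative_Group" "Graph_Theory.Graph_Theory"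
begin

section \<open>Groups given by generators and relations\<close>

text \<open>
  A letter \<open>(x, True)\<close> stands for the generator \<open>x\<close> and \<open>(x, False)\<close> for its formal inverse.
  A pair \<open>(u, v)\<close> in \<open>R\<close> is read as the defining relation \<open>u = v\<close>.
\<close>

type_synonym 'x word = "('x \<times> bool) list"

inductive pres_eq :: "('x word \<times> 'x word) set \<Rightarrow> 'x word \<Rightarrow> 'x word \<Rightarrow> bool"
  for R where
  refl: "pres_eq R u u"
| sym: "pres_eq R u v \<Longrightarrow> pres_eq R v u"
| trans: "pres_eq R u v \<Longrightarrow> pres_eq R v w \<Longrightarrow> pres_eq R u w"
| cancel: "pres_eq R (p @ [(x, s), (x, \<not> s)] @ q) (p @ q)"
| relation: "(u, v) \<in> R \<Longrightarrow> pres_eq R (p @ u @ q) (p @ v @ q)"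

definition presented_group :: "('x word \<times> 'x word) set \<Rightarrow> 'x word set monoid" where
  "presented_group R =
     \<lparr>carrier = UNIV // {(u, v). pres_eq R u v},
      monoid.mult = (\<lambda>U V. {w. \<exists>u\<in>U. \<exists>v\<in>V. pres_eq R (u @ v) w}),
      one = {w. pres_eq R [] w}\<rparr>"


section \<open>Dihedral groups\<close>

datatype dihedral_gen = Gen_a | Gen_b

definition dihedral_relations :: "nat \<Rightarrow> (dihedral_gen word \<times> dihedral_gen word) set" where
  "dihedral_relations n =
     {(replicate n (Gen_a, True), []),
      ([(Gen_b, True), (Gen_b, True)], []),
      ([(Gen_b, True), (Gen_a, True), (Gen_b, False)], [(Gen_a, False)])}"

text \<open>The parameter is \<open>n\<close>, the order of the group is \<open>2 * n\<close>.\<close>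

definition dihedral_group :: "nat \<Rightarrow> dihedral_gen word set monoid" where
  "dihedral_group n = presented_group (dihedral_relations n)"


section \<open>Independence number\<close>

definition independent_set :: "'a pair_pre_digraph \<Rightarrow> 'a set \<Rightarrow> bool" where
  "independent_set \<Gamma> S \<longleftrightarrow> S \<subseteq> pverts \<Gamma> \<and> (\<forall>u\<in>S. \<forall>v\<in>S. \<not> u \<rightarrow>\<^bsub>with_proj \<Gamma>\<^esub> v)"

text \<open>Only meaningful for graphs with finitely many vertices.\<close>

definition independence_number :: "'a pair_pre_digraph \<Rightarrow> nat" where
  "independence_number \<Gamma> = Max {card S | S. independent_set \<Gamma> S}"


section \<open>The prime-coprime graph\<close>

text \<open>A simple graph is represented by its symmetric, irreflexive arc relation.\<close>

definition prime_coprime_graph :: "('g, 'm) monoid_scheme \<Rightarrow> 'g pair_pre_digraph" where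
  "prime_coprime_graph G =
     \<lparr>pverts = carrier G,
      parcs = {(g, h). g \<in> carrier G \<and> h \<in> carrier G \<and> g \<noteq> h \<and>
        (gcd (group.ord G g) (group.ord G h) = 1 \<or> prime (gcd (group.ord G g) (group.ord G h)))}\<rparr>"


section \<open>Well-formedness of the definitions\<close>

lemma pair_graph_prime_coprime_graph:
  assumes "finite (carrier G)"
  shows "pair_graph (prime_coprime_graph G)"
proof
  have "parcs (prime_coprime_graph G) \<subseteq> carrier G \<times> carrier G"
    by (auto simp: prime_coprime_graph_def)
  then show "finite (parcs (prime_coprime_graph G))"
    using assms finite_subset by blast
qed (use assms in \<open>auto simp: prime_coprime_graph_def symmetric_def sym_def gcd.commute\<close>)

lemma equiv_pres_eq: "equiv UNIV {(u, v). pres_eq R u v}"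
  by (rule equivI) (auto simp: refl_on_def sym_def trans_def intro: pres_eq.intros)

lemma pres_eq_context: "pres_eq R u v \<Longrightarrow> pres_eq R (p @ u @ q) (p @ v @ q)"
proof (induction rule: pres_eq.induct)
  case (cancel p' x s q')
  show ?case using pres_eq.cancel[of R "p @ p'" x s "q' @ q"] by simp
next
  case (relation u v p' q')
  then show ?case using pres_eq.relation[of u v R "p @ p'" "q' @ q"] by simp
qed (blast intro: pres_eq.intros)+

lemma pres_eq_append:
  assumes "pres_eq R u u'" "pres_eq R v v'"
  shows "pres_eq R (u @ v) (u' @ v')"
  using pres_eq_context[OF assms(1), of "[]" v] pres_eq_context[OF assms(2), of u' "[]"]
  by (auto intro: pres_eq.trans)

lemma pres_eq_class_iff: "{w. pres_eq R u w} = {w. pres_eq R v w} \<longleftrightarrow> pres_eq R u v"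
  by (blast intro: pres_eq.intros)

lemma carrier_presented_group: "carrier (presented_group R) = range (\<lambda>u. {w. pres_eq R u w})"
  by (auto simp: presented_group_def quotient_def)

lemma class_in_presented_group: "{w. pres_eq R u w} \<in> carrier (presented_group R)"
  unfolding carrier_presented_group by (rule rangeI)

lemma one_presented_group: "\<one>\<^bsub>presented_group R\<^esub> = {w. pres_eq R [] w}"
  by (simp add: presented_group_def)

lemma mult_presented_group:
  "{w. pres_eq R u w} \<otimes>\<^bsub>presented_group R\<^esub> {w. pres_eq R v w} = {w. pres_eq R (u @ v) w}"
  by (auto simp: presented_group_def intro: pres_eq.trans pres_eq_append pres_eq.refl)

lemma pres_eq_inverse:
  "pres_eq R (rev (map (\<lambda>(x, s). (x, \<not> s)) u) @ u) []"
proof (induction u)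
  case (Cons l u)
  obtain x s where l: "l = (x, s)" by (cases l)
  let ?v = "rev (map (\<lambda>(x, s). (x, \<not> s)) u)"
  have "pres_eq R (?v @ [(x, \<not> s), (x, s)] @ u) (?v @ u)"
    using pres_eq.cancel[of R ?v x "\<not> s" u] by simp
  then show ?case using Cons.IH by (auto simp: l intro: pres_eq.trans)
qed (simp add: pres_eq.refl)

lemma group_presented_group: "group (presented_group R)"
proof (rule groupI)
  fix U assume "U \<in> carrier (presented_group R)"
  then obtain u where U: "U = {w. pres_eq R u w}" by (auto simp: carrier_presented_group)
  show "\<exists>V\<in>carrier (presented_group R). V \<otimes>\<^bsub>presented_group R\<^esub> U = \<one>\<^bsub>presented_group R\<^esub>"
    by (rule bexI[of _ "{w. pres_eq R (rev (map (\<lambda>(x, s). (x, \<not> s)) u)) w}"])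
      (simp_all add: U mult_presented_group one_presented_group pres_eq_class_iff
        pres_eq_inverse class_in_presented_group)
qed (auto simp: carrier_presented_group mult_presented_group one_presented_group)

lemma group_dihedral_group: "group (dihedral_group n)"
  unfolding dihedral_group_def by (rule group_presented_group)

context
  fixes n :: nat
  assumes n: "n > 0"
begin

private abbreviation deq (infix "\<sim>" 50) where "u \<sim> v \<equiv> pres_eq (dihedral_relations n) u v"

private abbreviation nf :: "nat \<Rightarrow> nat \<Rightarrow> dihedral_gen word" where
  "nf k j \<equiv> replicate k (Gen_a, True) @ replicate j (Gen_b, True)"

private lemma a_pow: "p @ replicate n (Gen_a, True) @ q \<sim> p @ q"
  using pres_eq.relation[of "replicate n (Gen_a, True)" "[]" "dihedral_relations n" p q]
  by (simp add: dihedral_relations_def)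

private lemma b_sq: "p @ [(Gen_b, True), (Gen_b, True)] @ q \<sim> p @ q"
  using pres_eq.relation[of "[(Gen_b, True), (Gen_b, True)]" "[]" "dihedral_relations n" p q]
  by (simp add: dihedral_relations_def)

private lemma a_inv: "(Gen_a, False) # q \<sim> replicate (n - 1) (Gen_a, True) @ q"
proof -
  have eq: "replicate n (Gen_a, True) = (Gen_a, True) # replicate (n - 1) (Gen_a, True)"
    using n by (cases n) auto
  have "(Gen_a, False) # q \<sim> [(Gen_a, False)] @ replicate n (Gen_a, True) @ q"
    using a_pow[of "[(Gen_a, False)]" q] by (auto intro: pres_eq.sym)
  moreover have "[(Gen_a, False)] @ replicate n (Gen_a, True) @ q
      \<sim> replicate (n - 1) (Gen_a, True) @ q"
    using pres_eq.cancel[of _ "[]" Gen_a False "replicate (n - 1) (Gen_a, True) @ q"]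
    by (simp add: eq)
  ultimately show ?thesis by (rule pres_eq.trans)
qed

private lemma b_inv: "(Gen_b, False) # q \<sim> (Gen_b, True) # q"
  using pres_eq.trans[OF pres_eq.sym[OF b_sq[of "[(Gen_b, False)]" q]],
      of "(Gen_b, True) # q"] pres_eq.cancel[of "dihedral_relations n" "[]" Gen_b False "(Gen_b, True) # q"]
  by simp

private lemma b_a: "(Gen_b, True) # (Gen_a, True) # q \<sim> replicate (n - 1) (Gen_a, True) @ (Gen_b, True) # q"
proof -
  let ?R = "dihedral_relations n"
  have "[(Gen_b, True), (Gen_a, True)] @ q
      \<sim> [(Gen_b, True), (Gen_a, True)] @ [(Gen_b, False), (Gen_b, True)] @ q"
    using pres_eq.cancel[of ?R "[(Gen_b, True), (Gen_a, True)]" Gen_b False q]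
    by (auto intro: pres_eq.sym)
  also have "\<dots> \<sim> (Gen_a, False) # (Gen_b, True) # q" (is "pres_eq _ ?x ?y")
    using pres_eq.relation[of "[(Gen_b, True), (Gen_a, True), (Gen_b, False)]" "[(Gen_a, False)]"
        ?R "[]" "(Gen_b, True) # q"]
    by (simp add: dihedral_relations_def)
  finally (pres_eq.trans) show ?thesis using a_inv pres_eq.trans by fastforce
qed

private lemma b_a_pow:
  "(Gen_b, True) # replicate k (Gen_a, True) @ q
    \<sim> replicate (k * (n - 1)) (Gen_a, True) @ (Gen_b, True) # q"
proof (induction k)
  case (Suc k)
  have "(Gen_b, True) # replicate (Suc k) (Gen_a, True) @ q
      \<sim> replicate (n - 1) (Gen_a, True) @ (Gen_b, True) # replicate k (Gen_a, True) @ q"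
    using b_a[of "replicate k (Gen_a, True) @ q"] by simp
  also have "\<dots> \<sim> replicate (n - 1) (Gen_a, True) @
      (replicate (k * (n - 1)) (Gen_a, True) @ (Gen_b, True) # q)"
    by (intro pres_eq_append pres_eq.refl Suc.IH)
  finally (pres_eq.trans) show ?case by (simp add: replicate_add)
qed (simp add: pres_eq.refl)

private lemma a_pow_mod: "replicate k (Gen_a, True) @ q \<sim> replicate (k mod n) (Gen_a, True) @ q"
proof (induction k rule: less_induct)
  case (less k)
  show ?case
  proof (cases "k < n")
    case False
    then have k: "replicate k (Gen_a, True) @ q
        = [] @ replicate n (Gen_a, True) @ replicate (k - n) (Gen_a, True) @ q"
      by (simp flip: append_assoc replicate_add)
    have "replicate k (Gen_a, True) @ q \<sim> replicate (k - n) (Gen_a, True) @ q"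
      unfolding k using a_pow[of "[]"] by simp
    moreover have "(k - n) mod n = k mod n"
      using False by (simp add: le_mod_geq)
    ultimately show ?thesis using less.IH[of "k - n"] False n
      by (auto intro: pres_eq.trans)
  qed (simp add: pres_eq.refl)
qed

private lemma b_pow_mod: "p @ replicate j (Gen_b, True) \<sim> p @ replicate (j mod 2) (Gen_b, True)"
proof (induction j rule: less_induct)
  case (less j)
  show ?case
  proof (cases "j < 2")
    case False
    then have j: "j = Suc (Suc (j - 2))" by simp
    have "p @ replicate j (Gen_b, True) \<sim> p @ replicate (j - 2) (Gen_b, True)"
      using b_sq[of p "replicate (j - 2) (Gen_b, True)"] by (subst j) simp
    moreover have "(j - 2) mod 2 = j mod 2"
      using False by (simp add: le_mod_geq)
    ultimately show ?thesis using less.IH[of "j - 2"] False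
      by (auto intro: pres_eq.trans)
  qed (simp add: pres_eq.refl)
qed

private lemma ex_nf: "\<exists>k j. w \<sim> nf k j"
proof (induction w)
  case Nil
  show ?case using pres_eq.refl[of _ "[]"] by (metis append_Nil replicate_0)
next
  case (Cons l w)
  then obtain k j where w: "w \<sim> nf k j" by blast
  obtain x s where l: "l = (x, s)" by (cases l)
  have lw: "l # w \<sim> l # nf k j"
    using pres_eq_append[OF pres_eq.refl[of _ "[l]"] w] by simp
  have "\<exists>k' j'. l # nf k j \<sim> nf k' j'"
  proof (cases x)
    case Gen_a
    show ?thesis
    proof (cases s)
      case True
      then have "l # nf k j = nf (Suc k) j" using Gen_a l by simp
      then show ?thesis by (metis pres_eq.refl)
    next
      case False
      then have "l # nf k j \<sim> nf (n - 1 + k) j"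
        using Gen_a l a_inv[of "nf k j"] by (simp add: replicate_add)
      then show ?thesis by blast
    qed
  next
    case Gen_b
    have "l # nf k j \<sim> (Gen_b, True) # nf k j"
      using Gen_b l b_inv by (cases s) (auto intro: pres_eq.refl)
    also have "\<dots> \<sim> nf (k * (n - 1)) (Suc j)"
      using b_a_pow[of k "replicate j (Gen_b, True)"] by simp
    finally (pres_eq.trans) show ?thesis by blast
  qed
  then show ?case using lw pres_eq.trans by blast
qed

private lemma ex_nf_less: "\<exists>k<n. \<exists>j<2. w \<sim> nf k j"
proof -
  obtain k j where "w \<sim> nf k j" using ex_nf by blast
  also have "nf k j \<sim> nf (k mod n) j" by (rule a_pow_mod)
  also (pres_eq.trans) have "nf (k mod n) j \<sim> nf (k mod n) (j mod 2)" by (rule b_pow_mod)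
  finally (pres_eq.trans) show ?thesis using n by (meson mod_less_divisor pos2)
qed

private fun act1 :: "dihedral_gen \<times> bool \<Rightarrow> int \<times> bool \<Rightarrow> int \<times> bool" where
  "act1 (Gen_a, s) (k, t) = ((if s then k + 1 else k - 1) mod int n, t)"
| "act1 (Gen_b, s) (k, t) = ((- k) mod int n, \<not> t)"

private abbreviation act :: "dihedral_gen word \<Rightarrow> int \<times> bool \<Rightarrow> int \<times> bool" where
  "act \<equiv> foldr act1"

private lemma act_dom: "fst x \<in> {0..<int n} \<Longrightarrow> fst (act w x) \<in> {0..<int n}"
proof (induction w)
  case (Cons l w)
  then show ?case using n by (cases l; cases "fst l"; cases "act w x") auto
qed simp

private lemma act_a_pow:
  "fst x \<in> {0..<int n} \<Longrightarrow> act (replicate k (Gen_a, True)) x = ((fst x + int k) mod int n, snd x)"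
proof (induction k)
  case (Suc k)
  then have "act (replicate (Suc k) (Gen_a, True)) x
      = (((fst x + int k) mod int n + 1) mod int n, snd x)" by simp
  then show ?case by (simp only: mod_add_left_eq of_nat_Suc prod.inject) (simp only: ac_simps)
qed (cases x; simp)

private lemma act_cong: "u \<sim> v \<Longrightarrow> fst x \<in> {0..<int n} \<Longrightarrow> act u x = act v x"
proof (induction arbitrary: x rule: pres_eq.induct)
  case (cancel p y s q)
  have "fst (act q x) \<in> {0..<int n}" using cancel act_dom by blast
  then have "act [(y, s), (y, \<not> s)] (act q x) = act q x"
    by (cases "act q x"; cases y) (auto simp: mod_simps)
  then show ?case by simp
next
  case (relation u v p q)
  have "fst (act q x) \<in> {0..<int n}" using relation act_dom by blast
  then have "act u (act q x) = act v (act q x)"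
    using relation(1) act_a_pow[of "act q x" n] unfolding dihedral_relations_def
    by (cases "act q x") (auto simp: mod_simps)
  then show ?case by simp
qed simp_all

private lemma act_nf: "k < n \<Longrightarrow> j < 2 \<Longrightarrow> act (nf k j) (0, False) = (int k, j = 1)"
proof -
  assume k: "k < n" and j: "j < 2"
  have "act (replicate j (Gen_b, True)) (0, False) = (0, j = 1)"
    using j by (cases "j = 0") (auto simp: less_2_cases_iff)
  then show ?thesis using k by (simp add: act_a_pow del: foldr_replicate)
qed

lemma order_dihedral_group: "order (dihedral_group n) = 2 * n"
proof -
  let ?f = "\<lambda>(k, j). {w. nf k j \<sim> w}"
  have "inj_on ?f ({..<n} \<times> {..<2})"
  proof (rule inj_onI, clarsimp simp: pres_eq_class_iff)
    fix k j k' j'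
    assume *: "k < n" "k' < n" "j < 2" "j' < (2 :: nat)" "nf k j \<sim> nf k' j'"
    have "act (nf k j) (0, False) = act (nf k' j') (0, False)"
      using act_cong[OF *(5), of "(0, False)"] n by simp
    then show "k = k' \<and> j = j'" using * by (auto simp only: act_nf)
  qed
  moreover have "?f ` ({..<n} \<times> {..<2}) = carrier (dihedral_group n)"
  proof
    show "carrier (dihedral_group n) \<subseteq> ?f ` ({..<n} \<times> {..<2})"
    proof
      fix U assume "U \<in> carrier (dihedral_group n)"
      then obtain w where U: "U = {v. w \<sim> v}"
        by (auto simp: dihedral_group_def carrier_presented_group)
      obtain k j where "k < n" "j < 2" "w \<sim> nf k j" using ex_nf_less by blast
      then show "U \<in> ?f ` ({..<n} \<times> {..<2})"
        unfolding U by (intro image_eqI[of _ _ "(k, j)"])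
          (simp_all only: pres_eq_class_iff case_prod_conv mem_Times_iff fst_conv snd_conv lessThan_iff)
    qed
  qed (auto simp: dihedral_group_def carrier_presented_group)
  ultimately have "bij_betw ?f ({..<n} \<times> {..<2}) (carrier (dihedral_group n))"
    by (simp only: bij_betw_def)
  from bij_betw_same_card[OF this] show ?thesis
    by (simp add: order_def card_cartesian_product)
qed

end

end

(*
  Every element of the dihedral group outside the rotation subgroup has order dividing 2, so it is
  adjacent to all other vertices and lies in no independent set with two or more elements. The
  rotation subgroup is a copy of the cyclic group of order n with the same element orders.
*)
theory Submission
  imports Defs
begin

section \<open>Element orders and independent sets under injective maps\<close>

lemma inj_hom_ord_eq:
  assumes "group G" "group H" "f \<in> hom G H" "inj_on f (carrier G)" "x \<in> carrier G"
  shows "group.ord H (f x) = group.ord G x"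
proof -
  interpret group_hom G H f
    using assms by (simp add: group_hom_def group_hom_axioms_def)
  \<comment> \<open>The order of an element is determined by the set of its multiples, that is, of
    the exponents that kill the element. This also covers infinite order, where \<open>ord\<close>
    is 0.\<close>
  have "f x [^]\<^bsub>H\<^esub> k = \<one>\<^bsub>H\<^esub> \<longleftrightarrow> group.ord G x dvd k" for k :: nat
  proof -
    have "f x [^]\<^bsub>H\<^esub> k = \<one>\<^bsub>H\<^esub> \<longleftrightarrow> f (x [^]\<^bsub>G\<^esub> k) = f \<one>\<^bsub>G\<^esub>"
      using assms(5) by (simp add: hom_nat_pow)
    also have "\<dots> \<longleftrightarrow> x [^]\<^bsub>G\<^esub> k = \<one>\<^bsub>G\<^esub>"
      by (rule inj_on_eq_iff[OF assms(4) G.nat_pow_closed[OF assms(5)] G.one_closed])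
    finally show ?thesis
      using assms(5) by (simp add: G.pow_eq_id)
  qed
  then show ?thesis
    using assms(5) by (simp add: H.ord_unique)
qed

lemma independent_prime_coprime_iff:
  "independent_set (prime_coprime_graph G) S \<longleftrightarrow> S \<subseteq> carrier G \<and>
    (\<forall>g\<in>S. \<forall>h\<in>S. g \<noteq> h \<longrightarrow> gcd (group.ord G g) (group.ord G h) \<noteq> 1 \<and>
      \<not> prime (gcd (group.ord G g) (group.ord G h)))"
  unfolding independent_set_def prime_coprime_graph_def by (auto simp: arcs_ends_def arc_to_ends_def)

text \<open>Adjacency depends only on distinctness and on the orders of the two elements, and
  \<open>f\<close> preserves both.\<close>

lemma independent_image_iff:
  assumes "inj_on f (carrier H)" "f ` carrier H \<subseteq> carrier G" "S \<subseteq> carrier H"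
    and "\<And>x. x \<in> carrier H \<Longrightarrow> group.ord G (f x) = group.ord H x"
  shows "independent_set (prime_coprime_graph G) (f ` S) \<longleftrightarrow>
    independent_set (prime_coprime_graph H) S"
proof -
  have "f x = f y \<longleftrightarrow> x = y" if "x \<in> S" "y \<in> S" for x y
    using that assms(1,3) by (meson inj_on_eq_iff subset_iff)
  then show ?thesis
    using assms(2-4) by (auto simp: independent_prime_coprime_iff subset_iff)
qed

text \<open>A divisor of 2 has gcd 1 or 2 with every number, so \<open>g\<close> would be adjacent
  to \<open>h\<close>.\<close>

lemma ord_dvd_2_not_in_independent:
  assumes "independent_set (prime_coprime_graph G) S" "g \<in> S" "h \<in> S" "g \<noteq> h"
  shows "\<not> group.ord G g dvd 2"
proof
  assume "group.ord G g dvd 2"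
  then have "gcd (group.ord G g) (group.ord G h) dvd 2"
    using gcd_dvd1 dvd_trans by blast
  then have "gcd (group.ord G g) (group.ord G h) \<in> {1, 2}"
    using prime_nat_iff[of 2] by auto
  then show False
    using assms unfolding independent_prime_coprime_iff by fastforce
qed

text \<open>The two sets of cardinalities under \<open>Max\<close> are shown to be equal, by moving
  independent sets along \<open>f\<close> in both directions.\<close>

lemma independence_number_prime_coprime_eq:
  assumes "group H" "group G" "f \<in> hom H G" "inj_on f (carrier H)"
    and ord2: "\<And>g. g \<in> carrier G - f ` carrier H \<Longrightarrow> group.ord G g dvd 2"
  shows "independence_number (prime_coprime_graph G) = independence_number (prime_coprime_graph H)"
proof -
  interpret H: group H by fact
  have img: "f ` carrier H \<subseteq> carrier G"
    using assms(3) by (auto simp: hom_def)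
  have ord: "\<And>x. x \<in> carrier H \<Longrightarrow> group.ord G (f x) = group.ord H x"
    using assms by (intro inj_hom_ord_eq)
  note iff = independent_image_iff[OF assms(4) img _ ord]
  let ?IG = "independent_set (prime_coprime_graph G)"
  let ?IH = "independent_set (prime_coprime_graph H)"
  have "\<exists>T. card S = card T \<and> ?IH T" if S: "?IG S" for S
  proof (cases "card S \<le> 1")
    \<comment> \<open>A singleton outside the image of \<open>f\<close> is independent too, so small
      sets are matched by cardinality alone. An infinite \<open>S\<close> also lands here, since its
      \<open>card\<close> is 0.\<close>
    case True
    then have "card S = card {} \<or> card S = card {\<one>\<^bsub>H\<^esub>}"
      by auto
    moreover have "?IH {}" "?IH {\<one>\<^bsub>H\<^esub>}"
      by (auto simp: independent_prime_coprime_iff)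
    ultimately show ?thesis
      by metis
  next
    case False
    have "S \<subseteq> f ` carrier H"
    proof
      fix g assume g: "g \<in> S"
      obtain h where h: "h \<in> S" "g \<noteq> h"
      proof -
        have "S \<noteq> {g}"
          using False by auto
        then show ?thesis
          using g that by blast
      qed
      have "g \<in> carrier G"
        using S g by (auto simp: independent_prime_coprime_iff)
      then show "g \<in> f ` carrier H"
        using ord2[of g] ord_dvd_2_not_in_independent[OF S g h] by blast
    qed
    then obtain T where T: "T \<subseteq> carrier H" "S = f ` T"
      by (auto simp: subset_image_iff)
    then have "card S = card T"
      using assms(4) by (metis card_image inj_on_subset)
    then show ?thesis
      using S T iff by blast
  qed
  moreover have "\<exists>S. card T = card S \<and> ?IG S" if "?IH T" for T
  proof -
    have T: "T \<subseteq> carrier H"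
      using that by (simp add: independent_prime_coprime_iff)
    then have "card (f ` T) = card T"
      using assms(4) by (metis card_image inj_on_subset)
    then show ?thesis
      using that iff[OF T] by metis
  qed
  ultimately have "{card S |S. ?IG S} = {card T |T. ?IH T}"
    by blast
  then show ?thesis
    by (simp add: independence_number_def)
qed

section \<open>Powers of an element that is inverted by conjugation\<close>

context group
begin

text \<open>Conjugation by \<open>y\<close> is an endomorphism and hence commutes with
  powers.\<close>

lemma conj_int_pow:
  assumes "x \<in> carrier G" "y \<in> carrier G"
  shows "y \<otimes> x [^] (i::int) \<otimes> inv y = (y \<otimes> x \<otimes> inv y) [^] i"
proof -
  have "(\<lambda>z. y \<otimes> z \<otimes> inv y) \<in> hom G G"
    using assms(2) by (auto simp: hom_def m_assoc inv_solve_left)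
  from hom_int_pow[OF this assms(1) is_group is_group] show ?thesis .
qed

lemma inverting_commute:
  assumes "a \<in> carrier G" "b \<in> carrier G" "b \<otimes> a \<otimes> inv b = inv a"
  shows "b \<otimes> a [^] (i::int) = a [^] (- i) \<otimes> b"
proof -
  have "b \<otimes> a [^] i \<otimes> inv b = a [^] (- i)"
    using conj_int_pow[OF assms(1,2), of i] assms by (simp add: int_pow_inv int_pow_neg)
  then show ?thesis
    using assms(1,2) by (metis inv_solve_right int_pow_closed m_closed)
qed

text \<open>In the square, moving the first \<open>b\<close> to the right past the power of
  \<open>a\<close> negates the exponent; the two powers cancel and \<open>b \<otimes> b\<close>
  remains.\<close>

lemma reflection_ord:
  assumes "a \<in> carrier G" "b \<in> carrier G" "b \<otimes> b = \<one>" "b \<otimes> a \<otimes> inv b = inv a"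
  shows "ord (a [^] (i::int) \<otimes> b) dvd 2"
proof -
  have "(a [^] i \<otimes> b) \<otimes> (a [^] i \<otimes> b) = a [^] i \<otimes> (b \<otimes> a [^] i) \<otimes> b"
    using assms(1,2) by (simp add: m_assoc)
  also have "\<dots> = (a [^] i \<otimes> a [^] (- i)) \<otimes> (b \<otimes> b)"
    using assms(1,2) by (simp only: inverting_commute[OF assms(1,2,4)] m_assoc int_pow_closed m_closed)
  also have "\<dots> = \<one>"
    using assms by (simp flip: int_pow_mult)
  finally show ?thesis
    using assms(1,2) by (simp flip: pow_eq_id add: numeral_2_eq_2)
qed

text \<open>Addition in \<open>integer_mod_group n\<close> reduces modulo \<open>n\<close>. This
  changes the exponent by a multiple of \<open>n\<close>, hence of \<open>ord a\<close>.\<close>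

lemma hom_integer_mod_group_pow:
  assumes "a \<in> carrier G" "a [^] (n::nat) = \<one>"
  shows "(\<lambda>i. a [^] i) \<in> hom (integer_mod_group n) G"
proof -
  have "ord a dvd n"
    using assms by (simp add: pow_eq_id)
  then have "int (ord a) dvd k - k mod int n" for k
    by (meson dvd_minus_mod dvd_trans int_dvd_int_iff)
  then have "a [^] ((i + j) mod int n) = a [^] (i + j)" for i j
    using assms(1) int_pow_eq by blast
  then show ?thesis
    using assms(1) by (simp add: hom_def int_pow_mult)
qed

end

section \<open>From the presentation to rotations and reflections\<close>

lemma dihedral_group_generators:
  obtains a b where "a \<in> carrier (dihedral_group n)" "b \<in> carrier (dihedral_group n)"
    "a [^]\<^bsub>dihedral_group n\<^esub> n = \<one>\<^bsub>dihedral_group n\<^esub>"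
    "b \<otimes>\<^bsub>dihedral_group n\<^esub> b = \<one>\<^bsub>dihedral_group n\<^esub>"
    "b \<otimes>\<^bsub>dihedral_group n\<^esub> a \<otimes>\<^bsub>dihedral_group n\<^esub> inv\<^bsub>dihedral_group n\<^esub> b = inv\<^bsub>dihedral_group n\<^esub> a"
    "carrier (dihedral_group n) =
      range (\<lambda>i::int. a [^]\<^bsub>dihedral_group n\<^esub> i) \<union>
      range (\<lambda>i::int. a [^]\<^bsub>dihedral_group n\<^esub> i \<otimes>\<^bsub>dihedral_group n\<^esub> b)"
proof -
  define R where "R = dihedral_relations n"
  define G where "G = dihedral_group n"
  \<comment> \<open>The quotient map from words to the group. The facts about \<open>c\<close> that
    follow turn the rules of \<open>pres_eq\<close> into group identities.\<close>
  define c where "c w = {v. pres_eq R w v}" for w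
  interpret group G
    unfolding G_def by (rule group_dihedral_group)
  have c_mult: "c u \<otimes>\<^bsub>G\<^esub> c v = c (u @ v)" for u v
    by (simp add: c_def R_def G_def dihedral_group_def mult_presented_group)
  have c_one: "\<one>\<^bsub>G\<^esub> = c []"
    by (simp add: c_def R_def G_def dihedral_group_def one_presented_group)
  have carr: "carrier G = range c"
    by (simp add: c_def[abs_def] R_def G_def dihedral_group_def carrier_presented_group)
  have c_closed [simp]: "c u \<in> carrier G" for u
    by (simp add: carr)
  have c_rel: "c u = c v" if "(u, v) \<in> R" for u v
    using pres_eq.relation[OF that, of "[]" "[]"] by (simp add: c_def pres_eq_class_iff)
  have c_inv: "c [(x, False)] = inv\<^bsub>G\<^esub> c [(x, True)]" for x
  proof (rule inv_equality[symmetric])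
    show "c [(x, False)] \<otimes>\<^bsub>G\<^esub> c [(x, True)] = \<one>\<^bsub>G\<^esub>"
      using pres_eq.cancel[of R "[]" x False "[]"]
      by (simp add: c_mult c_one) (simp add: c_def pres_eq_class_iff)
  qed simp_all
  define a where "a = c [(Gen_a, True)]"
  define b where "b = c [(Gen_b, True)]"
  have ab [simp]: "a \<in> carrier G" "b \<in> carrier G"
    by (simp_all add: a_def b_def)
  have "a [^]\<^bsub>G\<^esub> k = c (replicate k (Gen_a, True))" for k :: nat
    by (induction k) (simp_all add: c_one a_def c_mult replicate_append_same)
  then have an: "a [^]\<^bsub>G\<^esub> n = \<one>\<^bsub>G\<^esub>"
    by (simp add: c_one c_rel R_def dihedral_relations_def)
  have bb: "b \<otimes>\<^bsub>G\<^esub> b = \<one>\<^bsub>G\<^esub>"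
    by (simp add: b_def c_mult c_one c_rel R_def dihedral_relations_def)
  have bab: "b \<otimes>\<^bsub>G\<^esub> a \<otimes>\<^bsub>G\<^esub> inv\<^bsub>G\<^esub> b = inv\<^bsub>G\<^esub> a"
    by (simp add: a_def b_def c_mult c_rel R_def dihedral_relations_def flip: c_inv)
  \<comment> \<open>Rotations and reflections. Words grow at the front, so it suffices that the
    union contains the identity and is closed under left multiplication by each letter. Left
    multiplication by \<open>b\<close> swaps the two sets and negates the exponent.\<close>
  let ?A = "range (\<lambda>i::int. a [^]\<^bsub>G\<^esub> i)"
  let ?B = "range (\<lambda>i::int. a [^]\<^bsub>G\<^esub> i \<otimes>\<^bsub>G\<^esub> b)"
  have binv: "inv\<^bsub>G\<^esub> b = b"
    using bb by (simp add: inv_equality)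
  have a_cl: "a [^]\<^bsub>G\<^esub> j \<otimes>\<^bsub>G\<^esub> z \<in> ?A \<union> ?B" if "z \<in> ?A \<union> ?B" for z and j :: int
    using that by (auto simp: int_pow_mult simp flip: m_assoc int_pow_mult)
  have b_cl: "b \<otimes>\<^bsub>G\<^esub> z \<in> ?A \<union> ?B" if "z \<in> ?A \<union> ?B" for z
    using that
  proof
    assume "z \<in> ?A"
    then show ?thesis
      by (auto simp: inverting_commute[OF ab bab])
  next
    assume "z \<in> ?B"
    then obtain i :: int where "z = a [^]\<^bsub>G\<^esub> i \<otimes>\<^bsub>G\<^esub> b" by blast
    then have "b \<otimes>\<^bsub>G\<^esub> z = a [^]\<^bsub>G\<^esub> (- i) \<otimes>\<^bsub>G\<^esub> b \<otimes>\<^bsub>G\<^esub> b"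
      by (simp add: inverting_commute[OF ab bab] flip: m_assoc)
    also have "\<dots> = a [^]\<^bsub>G\<^esub> (- i)"
      using bb by (simp add: m_assoc del: int_pow_neg)
    finally show ?thesis by blast
  qed
  have "c w \<in> ?A \<union> ?B" for w
  proof (induction w)
    case Nil
    have "c [] = a [^]\<^bsub>G\<^esub> (0::int)"
      by (simp add: c_one)
    then show ?case by blast
  next
    case (Cons l w)
    obtain x s where l: "l = (x, s)" by (cases l)
    have "c (l # w) = c [(x, s)] \<otimes>\<^bsub>G\<^esub> c w"
      by (simp add: c_mult l)
    \<comment> \<open>Four letters give only three listed elements, because \<open>b\<close> is its
      own inverse.\<close>
    moreover have "c [(x, s)] \<in> {a [^]\<^bsub>G\<^esub> (1::int), a [^]\<^bsub>G\<^esub> (- 1::int), b}"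
      using binv by (cases x; cases s) (auto simp: a_def b_def c_inv int_pow_neg)
    ultimately show ?case
      using a_cl[OF Cons.IH, of 1] a_cl[OF Cons.IH, of "- 1"] b_cl[OF Cons.IH] by auto
  qed
  then have "carrier G = ?A \<union> ?B"
    by (auto simp: carr) (simp_all flip: carr)
  then show thesis
    using that[of a b] ab an bb bab unfolding G_def by blast
qed

section \<open>The cyclic group as the rotation subgroup\<close>

theorem proposition3p16:
  fixes n :: nat
  assumes "n \<ge> 3"
  shows "independence_number (prime_coprime_graph (dihedral_group n))
       = independence_number (prime_coprime_graph (integer_mod_group n))"
proof -
  let ?G = "dihedral_group n"
  let ?Z = "integer_mod_group n"
  interpret group ?G
    by (rule group_dihedral_group)
  obtain a b where a: "a \<in> carrier ?G" and b: "b \<in> carrier ?G"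
    and an: "a [^]\<^bsub>?G\<^esub> n = \<one>\<^bsub>?G\<^esub>" and bb: "b \<otimes>\<^bsub>?G\<^esub> b = \<one>\<^bsub>?G\<^esub>"
    and bab: "b \<otimes>\<^bsub>?G\<^esub> a \<otimes>\<^bsub>?G\<^esub> inv\<^bsub>?G\<^esub> b = inv\<^bsub>?G\<^esub> a"
    and carr: "carrier ?G = range (\<lambda>i::int. a [^]\<^bsub>?G\<^esub> i) \<union> range (\<lambda>i::int. a [^]\<^bsub>?G\<^esub> i \<otimes>\<^bsub>?G\<^esub> b)"
    using dihedral_group_generators .
  define f where "f i = a [^]\<^bsub>?G\<^esub> i" for i :: int
  \<comment> \<open>The bound on \<open>n\<close> excludes \<open>n = 0\<close>, for which
    \<open>integer_mod_group\<close> has all integers as its carrier.\<close>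
  have carrZ: "carrier ?Z = {0..<int n}"
    using assms by (simp add: carrier_integer_mod_group)
  have hom: "f \<in> hom ?Z ?G"
    using hom_integer_mod_group_pow[OF a an] by (simp add: f_def[abs_def])
  \<comment> \<open>As \<open>ord a\<close> divides \<open>n\<close>, every power of
    \<open>a\<close> already occurs with an exponent in \<open>{0..<int n}\<close>.\<close>
  have range_f: "range f = f ` carrier ?Z"
  proof -
    have "f i = f (i mod int n)" for i
    proof -
      have "int (ord a) dvd i mod int n - i"
        using a an by (metis dvd_minus_mod dvd_trans int_dvd_int_iff pow_eq_id dvd_diff_commute)
      then show ?thesis
        using a by (simp add: f_def int_pow_eq)
    qed
    moreover have "i mod int n \<in> carrier ?Z" for i
      using assms by (simp add: carrZ)
    ultimately show ?thesis
      by blast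
  qed
  have carr': "carrier ?G = f ` carrier ?Z \<union> (\<lambda>x. x \<otimes>\<^bsub>?G\<^esub> b) ` (f ` carrier ?Z)"
    unfolding carr range_f[symmetric] by (simp add: image_image f_def)
  have fin: "finite (carrier ?Z)" and cardZ: "card (carrier ?Z) = n"
    by (simp_all add: carrZ)
  \<comment> \<open>The relations alone give only that \<open>ord a\<close> divides
    \<open>n\<close>; injectivity comes from counting. The group of order \<open>2 * n\<close> is
    covered by the image of \<open>f\<close> and its right translate by \<open>b\<close>, so the
    image has at least \<open>n\<close> elements.\<close>
  have "2 * n = card (carrier ?G)"
    using order_dihedral_group[of n] assms by (simp add: order_def)
  also have "\<dots> \<le> card (f ` carrier ?Z) + card ((\<lambda>x. x \<otimes>\<^bsub>?G\<^esub> b) ` (f ` carrier ?Z))"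
    unfolding carr' by (rule card_Un_le)
  also have "\<dots> \<le> 2 * card (f ` carrier ?Z)"
    using card_image_le[of "f ` carrier ?Z" "\<lambda>x. x \<otimes>\<^bsub>?G\<^esub> b"] fin by simp
  finally have "card (f ` carrier ?Z) = card (carrier ?Z)"
    using card_image_le[OF fin, of f] cardZ by linarith
  then have inj: "inj_on f (carrier ?Z)"
    using fin by (rule eq_card_imp_inj_on[rotated])
  show ?thesis
  proof (rule independence_number_prime_coprime_eq[OF _ _ hom inj])
    fix g assume "g \<in> carrier ?G - f ` carrier ?Z"
    \<comment> \<open>The image of \<open>f\<close> contains all powers of \<open>a\<close>, so by
      \<open>carr\<close> only a reflection is left.\<close>
    then obtain i :: int where "g = a [^]\<^bsub>?G\<^esub> i \<otimes>\<^bsub>?G\<^esub> b"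
      unfolding carr range_f[symmetric] f_def by blast
    then show "ord g dvd 2"
      using reflection_ord[OF a b bb bab] by simp
  qed (simp_all add: is_group)
qed

end
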